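(* Let $0<q<1$ and let $ab,c\in\mathbb{R}$ with $c>0$ and $abq<c$. Put $$w_k=c^k\,\frac{(abq/c;q)_k}{(q;q)_k},\qquad k\in\mathbb{N}.$$ Let $L$ be the operator acting on sequences $u=(u_k)_{k\in\mathbb{N}}$ by $$(Lu)_k=(cq^{-k-1}-ab)(u_{k+1}-u_k)+(q^{-k}-1)(u_{k-1}-u_k)\quad(k\ge1),\qquad (Lu)_0=(cq^{-1}-ab)(u_1-u_0),$$ with domain $D(L)=\{u=(u_k)_{k\in\mathbb{N}}: u_k\ne0\text{ for at most finitely many }k\}$. Then $L$ is symmetric in the weighted space $\ell^2(\mathbb{N},w)$: $$\langle Lu,v\rangle=\langle u,Lv\rangle\qquad\text{for all }u,v\in D(L).$$
   Context: $\mathbb{N}=\{0,1,2,\dots\}$; $(x;q)_k=\prod_{j=0}^{k-1}(1-xq^j)$. $\ell^2(\mathbb{N},w)$ is the Hilbert space of complex sequences with inner product $\langle u,v\rangle=\sum_{k=0}^\infty u_k\overline{v_k}\,w_k$. The operator depends on $a,b$ only through the product $ab$. *)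

theory Defs imports Complex_Main begin

definition qpochhammer :: "real \<Rightarrow> real \<Rightarrow> nat \<Rightarrow> real" where
  "qpochhammer x q k = (\<Prod>j<k. 1 - x * q ^ j)"

definition weighted_l2 :: "(nat \<Rightarrow> real) \<Rightarrow> (nat \<Rightarrow> complex) set" where
  "weighted_l2 w = {u. summable (\<lambda>k. (cmod (u k))\<^sup>2 * w k)}"

definition weighted_inner :: "(nat \<Rightarrow> real) \<Rightarrow> (nat \<Rightarrow> complex) \<Rightarrow> (nat \<Rightarrow> complex) \<Rightarrow> complex" where
  "weighted_inner w u v = (\<Sum>k. u k * cnj (v k) * of_real (w k))"

(* An operator T with domain D is symmetric in the space of w-weighted square-summable sequences.
   Strict positivity of w makes weighted_inner an inner product; the two inclusions say that T is
   an operator in the space, so that the series on both sides of the identity converge. *)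
definition symmetric_in_weighted_l2 ::
    "(nat \<Rightarrow> real) \<Rightarrow> (nat \<Rightarrow> complex) set \<Rightarrow> ((nat \<Rightarrow> complex) \<Rightarrow> nat \<Rightarrow> complex) \<Rightarrow> bool" where
  "symmetric_in_weighted_l2 w D T \<longleftrightarrow>
     (\<forall>k. 0 < w k) \<and> D \<subseteq> weighted_l2 w \<and> T ` D \<subseteq> weighted_l2 w \<and>
     (\<forall>u\<in>D. \<forall>v\<in>D. weighted_inner w (T u) v = weighted_inner w u (T v))"

(* The operator and the weight involve the parameters a and b only through their product,
   so ab is a single real variable (a and b themselves need not be real). *)
definition weight :: "real \<Rightarrow> real \<Rightarrow> real \<Rightarrow> nat \<Rightarrow> real" where
  "weight q ab c k = c ^ k * (qpochhammer (ab * q / c) q k / qpochhammer q q k)"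

definition L_op :: "real \<Rightarrow> real \<Rightarrow> real \<Rightarrow> (nat \<Rightarrow> complex) \<Rightarrow> nat \<Rightarrow> complex" where
  "L_op q ab c u k =
     (if k = 0 then of_real (c * q powi (-1) - ab) * (u 1 - u 0)
      else of_real (c * q powi (- int k - 1) - ab) * (u (k + 1) - u k)
         + of_real (q powi (- int k) - 1) * (u (k - 1) - u k))"

definition L_dom :: "(nat \<Rightarrow> complex) set" where
  "L_dom = {u. finite {k. u k \<noteq> 0}}"

end

theory Submission imports Defs begin

text \<open>
  The operator is the generator of a birth-death process, with birth rates
  \<open>A k = c q^(-k-1) - ab\<close> and death rates \<open>B k = q^(-k) - 1\<close>. The death rate at \<open>0\<close> vanishes, so the
  boundary row needs no special treatment. Such an operator is symmetric for every weight in detailed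
  balance with the rates, \<open>w k * A k = w (k+1) * B (k+1)\<close>: the \<open>k\<close>-th summand of
  \<open>\<langle>Lu,v\<rangle> - \<langle>u,Lv\<rangle>\<close> is then the increment of the weighted Casoratian
  \<open>w k * A k * (u (k+1) * cnj (v k) - u k * cnj (v (k+1)))\<close>, so that the sum telescopes to a boundary
  term (lemma \<open>casoratian_telescope\<close>), which is zero beyond the supports.

  Detailed balance is how the weight arises (lemma \<open>weight_detailed_balance\<close>): the factor
  \<open>q^(-k-1)\<close> common to \<open>A k\<close> and \<open>B (k+1)\<close> cancels, which leaves the ratio
  \<open>w (k+1) / w k = (c - ab q^(k+1)) / (1 - q^(k+1))\<close>, whose products are
  quotients of q-shifted factorials. The assumption \<open>ab q < c\<close> makes every one of these ratios positive.
\<close>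

text \<open>Discrete Green formula. Detailed balance turns the death term at \<open>k + 1\<close> into
  the birth term at \<open>k\<close>, so all inner contributions cancel in pairs.\<close>

lemma casoratian_telescope:
  fixes A B w u v :: "nat \<Rightarrow> 'a::comm_ring_1"
  assumes "B 0 = 0"
    and balance: "\<And>k. w k * A k = w (Suc k) * B (Suc k)"
  defines "T \<equiv> \<lambda>u k. A k * (u (Suc k) - u k) + B k * (u (k - 1) - u k)"
  shows "(\<Sum>k\<le>n. (T u k * v k - u k * T v k) * w k) =
           w n * A n * (u (Suc n) * v n - u n * v (Suc n))"
proof (induction n)
  case 0
  then show ?case
    using \<open>B 0 = 0\<close> by (simp add: T_def algebra_simps)
next
  case (Suc n)
  show ?case
    unfolding sum.atMost_Suc Suc.IH balance[of n]
    by (simp add: T_def algebra_simps)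
qed

lemma qpochhammer_Suc: "qpochhammer x q (Suc k) = qpochhammer x q k * (1 - x * q ^ k)"
  by (simp add: qpochhammer_def)

lemma qpochhammer_pos:
  assumes "0 < q" "q < 1" "x < 1"
  shows "0 < qpochhammer x q k"
  unfolding qpochhammer_def
proof (rule prod_pos)
  fix j assume "j \<in> {..<k}"
  have "0 < q ^ j" "q ^ j \<le> 1"
    using assms by (simp_all add: power_le_one)
  then have "x * q ^ j < 1"
    using \<open>x < 1\<close> by (smt (verit) mult_less_cancel_right2 mult_nonpos_nonneg)
  then show "0 < 1 - x * q ^ j" by simp
qed

lemma weight_pos:
  assumes "0 < q" "q < 1" "0 < c" "ab * q < c"
  shows "0 < weight q ab c k"
  using assms by (simp add: weight_def qpochhammer_pos)

lemma weight_detailed_balance: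
  assumes "0 < q" "q < 1" "0 < c"
  shows "weight q ab c k * (c * q powi (- int k - 1) - ab) =
         weight q ab c (Suc k) * (q powi (- int (Suc k)) - 1)"
proof -
  have pow: "q powi (- int (Suc k)) = 1 / q ^ Suc k"
    unfolding power_int_minus power_int_of_nat by (simp add: divide_inverse)
  have index: "- int k - 1 = - int (Suc k)" by simp
  have "q ^ Suc k < 1"
    using assms by (intro power_Suc_less_one) auto
  then have ne: "1 - q * q ^ k \<noteq> 0" by simp
  have "weight q ab c (Suc k) = weight q ab c k * ((c - ab * q ^ Suc k) / (1 - q ^ Suc k))"
  proof -
    have factor: "c - ab * q ^ Suc k = c * (1 - ab * q / c * q ^ k)"
      using \<open>0 < c\<close> by (simp add: field_simps)
    show ?thesis
      unfolding factor weight_def qpochhammer_Suc by (simp add: ac_simps)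
  qed
  then show ?thesis
    unfolding index pow using \<open>0 < q\<close> ne by (simp add: field_simps)
qed

text \<open>Since \<open>q^0 - 1 = 0\<close> and \<open>0 - 1 = 0\<close> in the natural numbers, one formula covers the row \<open>k = 0\<close>.\<close>

lemma L_op_birth_death:
  "L_op q ab c u =
     (\<lambda>k. of_real (c * q powi (- int k - 1) - ab) * (u (Suc k) - u k)
        + of_real (q powi (- int k) - 1) * (u (k - 1) - u k))"
  by (rule ext) (simp add: L_op_def)

text \<open>The rates are real. Hence the bilinear identity \<open>casoratian_telescope\<close>, applied to \<open>u\<close> and
  the conjugate of \<open>v\<close>, yields the sesquilinear one.\<close>

lemma L_op_cnj: "L_op q ab c (\<lambda>k. cnj (v k)) = (\<lambda>k. cnj (L_op q ab c v k))"
  by (simp add: L_op_birth_death)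

lemma L_op_eq_0:
  assumes "\<And>k. n \<le> k \<Longrightarrow> u k = 0" and "n < k"
  shows "L_op q ab c u k = 0"
  using assms by (simp add: L_op_birth_death)

lemma L_dom_support_bounded:
  assumes "u \<in> L_dom"
  obtains n where "\<And>k. n \<le> k \<Longrightarrow> u k = 0"
proof -
  have "finite {k. u k \<noteq> 0}" using assms by (simp add: L_dom_def)
  then obtain n where "\<forall>k\<in>{k. u k \<noteq> 0}. k < n"
    using finite_nat_set_iff_bounded by blast
  then show thesis by (intro that[of n]) force
qed

lemma L_op_in_L_dom:
  assumes "u \<in> L_dom"
  shows "L_op q ab c u \<in> L_dom"
proof -
  obtain n where "\<And>k. n \<le> k \<Longrightarrow> u k = 0"
    using assms by (rule L_dom_support_bounded) blast
  then have "{k. L_op q ab c u k \<noteq> 0} \<subseteq> {..n}"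
    using L_op_eq_0[of n u] by (auto simp flip: not_less)
  then show ?thesis
    unfolding L_dom_def using finite_subset by blast
qed

lemma L_dom_subset_weighted_l2: "L_dom \<subseteq> weighted_l2 w"
  unfolding L_dom_def weighted_l2_def
  by (auto intro!: summable_finite)

lemma weighted_inner_eq_sum:
  assumes "\<And>k. n < k \<Longrightarrow> u k * cnj (v k) = 0"
  shows "weighted_inner w u v = (\<Sum>k\<le>n. u k * cnj (v k) * of_real (w k))"
  unfolding weighted_inner_def using assms by (intro suminf_finite) auto

lemma weighted_inner_L_op_commute:
  fixes q ab c :: real
  assumes "0 < q" "q < 1" "0 < c" and "u \<in> L_dom" "v \<in> L_dom"
  defines "L \<equiv> L_op q ab c" and "w \<equiv> weight q ab c"
  shows "weighted_inner w (L u) v = weighted_inner w u (L v)"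
proof -
  obtain n m where "\<And>k. n \<le> k \<Longrightarrow> u k = 0" "\<And>k. m \<le> k \<Longrightarrow> v k = 0"
    using L_dom_support_bounded assms(4,5) by metis
  then have zero: "\<And>k. max n m \<le> k \<Longrightarrow> u k = 0" "\<And>k. max n m \<le> k \<Longrightarrow> v k = 0"
    by auto
  define N where "N = max n m"
  define A where "A k = complex_of_real (c * q powi (- int k - 1) - ab)" for k
  define B where "B k = complex_of_real (q powi (- int k) - 1)" for k
  have "of_real (w k) * A k = of_real (w (Suc k)) * B (Suc k)" for k
    unfolding A_def B_def w_def of_real_mult[symmetric]
    by (subst weight_detailed_balance[OF assms(1-3)]) simp
  moreover have "B 0 = 0" by (simp add: B_def)
  ultimately have
    "(\<Sum>k\<le>N. (L u k * cnj (v k) - u k * L (\<lambda>k. cnj (v k)) k) * of_real (w k)) =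
       of_real (w N) * A N * (u (Suc N) * cnj (v N) - u N * cnj (v (Suc N)))"
    unfolding L_def L_op_birth_death A_def[symmetric] B_def[symmetric]
    by (intro casoratian_telescope)
  also have "\<dots> = 0"
    using zero by (simp add: N_def)
  finally have "(\<Sum>k\<le>N. L u k * cnj (v k) * of_real (w k)) =
                (\<Sum>k\<le>N. u k * cnj (L v k) * of_real (w k))"
    unfolding L_def L_op_cnj by (simp add: left_diff_distrib sum_subtractf)
  moreover have "weighted_inner w (L u) v = (\<Sum>k\<le>N. L u k * cnj (v k) * of_real (w k))"
    using zero(2) unfolding N_def by (intro weighted_inner_eq_sum) simp
  moreover have "weighted_inner w u (L v) = (\<Sum>k\<le>N. u k * cnj (L v k) * of_real (w k))"
    using zero(1) unfolding N_def by (intro weighted_inner_eq_sum) simp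
  ultimately show ?thesis by simp
qed

theorem proposition4p2:
  fixes q ab c :: real
  assumes "0 < q" and "q < 1" and "0 < c" and "ab * q < c"
  shows "symmetric_in_weighted_l2 (weight q ab c) L_dom (L_op q ab c)"
  unfolding symmetric_in_weighted_l2_def
proof (intro conjI ballI allI)
  show "0 < weight q ab c k" for k
    using assms by (rule weight_pos)
  show "L_dom \<subseteq> weighted_l2 (weight q ab c)"
    by (rule L_dom_subset_weighted_l2)
  show "L_op q ab c ` L_dom \<subseteq> weighted_l2 (weight q ab c)"
    using L_op_in_L_dom L_dom_subset_weighted_l2 by blast
  show "weighted_inner (weight q ab c) (L_op q ab c u) v
      = weighted_inner (weight q ab c) u (L_op q ab c v)"
    if "u \<in> L_dom" "v \<in> L_dom" for u v
    using assms(1-3) that by (rule weighted_inner_L_op_commute)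
qed

end
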